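(* Let $\beta_1,\beta_2>0$ and $-1<D<C\leq 1$ be real numbers with $(2\beta_1-\beta_2)(1-D^2)\geq 2\sqrt{2}\,(C-D)(1+|D|)$. Let $p$ be an analytic function in $\mathbb{D}$ with $p(0)=1$ and $$1+\beta_1 zp'(z)+\beta_2 z^2p''(z)\prec \frac{1+Cz}{1+Dz}.$$ Then $p(z)\prec 1+\sinh^{-1}z$.
   Context: $\mathbb{D}=\{z\in\mathbb{C}:|z|<1\}$. For functions $f,g$ analytic in $\mathbb{D}$, $f\prec g$ ($f$ is subordinate to $g$) means there is an analytic $w:\mathbb{D}\to\mathbb{C}$ with $w(0)=0$ and $|w(z)|\leq|z|$ such that $f(z)=g(w(z))$ for all $z\in\mathbb{D}$. $\sinh^{-1}z=\log(z+\sqrt{1+z^2})$ is the principal branch of the inverse hyperbolic sine, analytic on $\mathbb{D}$ with value $0$ at $0$. *)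

theory Defs
  imports "HOL-Complex_Analysis.Complex_Analysis"
begin

text \<open>Subordination in the unit disc. It is only meaningful for functions analytic in the disc,
  so that requirement is part of the predicate; values outside the disc are irrelevant.\<close>

definition subordinate :: "(complex \<Rightarrow> complex) \<Rightarrow> (complex \<Rightarrow> complex) \<Rightarrow> bool"
    (infix "\<prec>\<^sub>s" 50) where
  "f \<prec>\<^sub>s g \<longleftrightarrow>
     f analytic_on ball 0 1 \<and> g analytic_on ball 0 1 \<and>
     (\<exists>w. w analytic_on ball 0 1 \<and> w 0 = 0 \<and>
          (\<forall>z\<in>ball 0 1. norm (w z) \<le> norm z \<and> f z = g (w z)))"

text \<open>The library's \<^const>\<open>arsinh\<close> is defined with \<open>powr\<close>; on the complex numbers it is the
  principal branch of the inverse hyperbolic sine.\<close>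

lemma arsinh_complex_eq: "arsinh z = Ln (z + csqrt (1 + z\<^sup>2))" for z :: complex
  by (cases "z\<^sup>2 + 1 = 0") (auto simp: arsinh_def csqrt_conv_powr add.commute)

end

theory Submission
  imports Defs
begin

text \<open>Writing \<open>g = p'\<close>, the hypothesis says that \<open>\<beta>1 g(z) + \<beta>2 z g'(z)\<close> is bounded by
  \<open>K = (C - D) / (1 - \<bar>D\<bar>)\<close>. Integrating the derivative of \<open>t powr (\<beta>1 / \<beta>2) * g(t z)\<close> along
  the ray from \<open>0\<close> to \<open>z\<close> gives \<open>\<bar>g\<bar> \<le> K / \<beta>1\<close>, hence \<open>\<bar>p - 1\<bar> \<le> K / \<beta>1\<close>, which the condition
  on the parameters makes smaller than \<open>3/4\<close>. On that disc \<open>arsinh\<close> inverts \<open>sinh\<close> and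
  \<open>\<bar>sinh\<bar> < 1\<close>, so \<open>sinh (p - 1)\<close> is the required Schwarz function.\<close>

text \<open>The power series of \<open>sinh\<close> has nonnegative coefficients, so it is dominated
  term by term by the series at \<open>norm z\<close>.\<close>

lemma norm_sinh_le: "norm (sinh z) \<le> sinh (norm z)"
  for z :: "'a::{banach,real_normed_field}"
  by (rule norm_sums_le[OF sinh_converges sinh_converges]) (simp add: norm_power)

text \<open>The value \<open>3/4\<close> is a convenient rational between 1 / sqrt 2, the bound that
  the parameters give, and ln (1 + sqrt 2), where \<open>sinh\<close> reaches 1.\<close>

lemma sinh_three_quarters_less_1: "sinh (3/4 :: real) < 1"
proof -
  define x where "x = exp (3/4 :: real)"
  \<comment> \<open>The fourth power removes the fractional exponent, so a decimal bound on e
    suffices.\<close>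
  have "x ^ 4 = exp 1 ^ 3"
    by (simp add: x_def flip: exp_of_nat_mult)
  also have "\<dots> < (272/100) ^ 3"
    by (intro power_strict_mono e_less_272) auto
  also have "\<dots> < (24/10) ^ 4"
    by (simp add: power_numeral_reduce)
  finally have "x < 24/10"
    by (rule power_less_imp_less_base) simp
  moreover have "x > 0"
    by (simp add: x_def)
  \<comment> \<open>The map x - 1/x increases for x > 0 and is still below 2 at 2.4.\<close>
  ultimately have "x - 1 / x < 2"
    using divide_strict_left_mono[of x "24/10" 1] by simp
  then show ?thesis
    by (simp add: sinh_field_def x_def exp_minus field_simps)
qed

lemma norm_sinh_less_1:
  fixes z :: "'a::{banach,real_normed_field}"
  assumes "norm z \<le> 3/4"
  shows "norm (sinh z) < 1"
proof -
  have "sinh (norm z) \<le> sinh (3/4)"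
    using assms by simp
  then show ?thesis
    using norm_sinh_le[of z] sinh_three_quarters_less_1 by linarith
qed

text \<open>On this strip \<open>cosh z\<close> has positive real part, so it is the principal root
  of \<open>1 + (sinh z)\<^sup>2\<close>. The logarithm is then applied to \<open>exp z\<close> with
  \<bar>Im z\<bar> < pi.\<close>

lemma arsinh_sinh_complex:
  fixes z :: complex
  assumes "\<bar>Im z\<bar> < pi / 2"
  shows "arsinh (sinh z) = z"
proof -
  have "Re (cosh z) = cosh (Re z) * cos (Im z)"
    by (simp add: cosh_def Re_exp field_simps)
  also have "\<dots> > 0"
    using assms by (intro mult_pos_pos cos_gt_zero_pi) auto
  finally have "csqrt (1 + (sinh z)\<^sup>2) = cosh z"
    by (intro csqrt_unique) (auto simp: cosh_square_eq add.commute)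
  then show ?thesis
    using assms by (simp add: arsinh_complex_eq sinh_plus_cosh)
qed

text \<open>Neither branch cut is met: the radicand has positive real part in the disc, and the
  argument of \<open>Ln\<close> avoids its cut for every z.\<close>

lemma analytic_on_arsinh_ball: "(arsinh :: complex \<Rightarrow> complex) analytic_on ball 0 1"
proof -
  have 1: "1 + z\<^sup>2 \<notin> \<real>\<^sub>\<le>\<^sub>0" if "z \<in> ball 0 1" for z :: complex
  proof
    assume "1 + z\<^sup>2 \<in> \<real>\<^sub>\<le>\<^sub>0"
    then have "Re (1 + z\<^sup>2) \<le> 0"
      by (simp add: complex_nonpos_Reals_iff)
    moreover have "norm (z\<^sup>2) < 1"
      using that by (simp add: norm_power power_less_one_iff)
    ultimately show False
      using abs_Re_le_cmod[of "z\<^sup>2"] by simp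
  qed
  have 2: "z + csqrt (1 + z\<^sup>2) \<notin> \<real>\<^sub>\<le>\<^sub>0" for z :: complex
  proof
    define s where "s = csqrt (1 + z\<^sup>2)"
    assume "z + csqrt (1 + z\<^sup>2) \<in> \<real>\<^sub>\<le>\<^sub>0"
    then obtain r where r: "z + s = of_real r" "r \<le> 0"
      by (auto simp: s_def elim!: nonpos_Reals_cases)
    \<comment> \<open>The conjugate factor s - z is the inverse of z + s = r. Adding the two gives
      2s = r + 1/r < 0, against Re s \<ge> 0.\<close>
    have "(s - z) * (z + s) = s\<^sup>2 - z\<^sup>2"
      by algebra
    also have "\<dots> = 1"
      by (simp add: s_def)
    finally have *: "(s - z) * of_real r = 1"
      by (simp add: r)
    then have "r < 0"
      using r by (cases "r = 0") auto
    moreover from * \<open>r < 0\<close> have "s - z = of_real (1 / r)"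
      by (simp add: field_simps)
    ultimately have "Re (2 * s) < 0"
      using arg_cong[OF r(1), of Re] arg_cong[of "s - z" _ Re]
      by (smt (verit) Re_complex_of_real divide_pos_neg minus_complex.sel(1) mult_2 plus_complex.sel(1))
    then show False
      using Re_csqrt[of "1 + z\<^sup>2"] by (simp add: s_def)
  qed
  have "(\<lambda>z::complex. Ln (z + csqrt (1 + z\<^sup>2))) analytic_on ball 0 1"
    using 2 by (intro analytic_intros 1) auto
  then show ?thesis
    by (simp add: arsinh_complex_eq[abs_def])
qed

text \<open>The bound is assumed only off 0 because in the application it arises on division by z;
  continuity of \<open>g\<close> recovers the centre.\<close>

lemma norm_le_if_first_order_differential_bound:
  fixes g :: "complex \<Rightarrow> complex" and a b K R :: real
  assumes "a > 0" "b > 0" and hol: "g holomorphic_on ball 0 R"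
    and bound: "\<And>z. z \<in> ball 0 R - {0} \<Longrightarrow>
      norm (of_real a * g z + of_real b * z * deriv g z) \<le> K"
    and z: "z \<in> ball 0 R"
  shows "norm (g z) \<le> K / a"
proof -
  have nz: "norm (g z) \<le> K / a" if z: "z \<in> ball 0 R - {0}" for z
  proof -
    define c where "c = a / b"
    have c: "c > 0" "K / a * c = K / b"
      using assms(1,2) by (auto simp: c_def)
    define f where "f = (\<lambda>t::real. of_real (t powr c) * g (of_real t * z))"
    have ball: "of_real t * z \<in> ball 0 R" if "0 \<le> t" "t \<le> 1" for t :: real
    proof -
      have "t * norm z \<le> norm z"
        using that by (simp add: mult_left_le_one_le)
      also have "\<dots> < R"
        using z by simp
      finally show ?thesis
        using that by (simp add: norm_mult)
    qed
    have powr_cont: "continuous_on {0..1} (\<lambda>t::real. t powr c)"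
      using c by (intro continuous_intros continuous_on_powr') auto
    have "continuous_on {0..1} (\<lambda>t::real. g (of_real t * z))"
      using ball
      by (intro continuous_on_compose2[OF holomorphic_on_imp_continuous_on[OF hol]] continuous_intros)
        auto
    note f_cont = continuous_on_mult[OF continuous_on_of_real[OF powr_cont] this]
    \<comment> \<open>The integration is done as a mean value inequality against
      \<open>K / a * t powr c\<close>. It asks only for continuity at the endpoints, which matters
      because \<open>t powr (c - 1)\<close> is unbounded near 0 when c < 1.\<close>
    have "norm (f 1 - f 0) \<le> K / a * 1 powr c - K / a * 0 powr c"
    proof (rule differentiable_bound_general[where
          f' = "\<lambda>t. of_real (t powr (c - 1) / b) *
            (of_real a * g (of_real t * z) + of_real b * (of_real t * z) * deriv g (of_real t * z))"
          and \<phi>' = "\<lambda>t. K / a * (c * t powr (c - 1))"])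
      show "continuous_on {0..1} f"
        unfolding f_def by (rule f_cont)
      show "continuous_on {0..1} (\<lambda>t. K / a * t powr c)"
        by (intro continuous_intros powr_cont)
    next
      fix t :: real
      assume t: "0 < t" "t < 1"
      have powr: "((\<lambda>t. t powr c) has_real_derivative c * t powr (c - 1)) (at t)"
        using t by (intro has_real_derivative_powr)
      show "((\<lambda>t. K / a * t powr c) has_vector_derivative K / a * (c * t powr (c - 1))) (at t)"
        using DERIV_cmult[OF powr, of "K / a"]
        by (simp add: has_real_derivative_iff_has_vector_derivative)
      have "(g has_field_derivative deriv g (of_real t * z)) (at (of_real t * z))"
        using hol ball[of t] t by (intro holomorphic_derivI[of _ "ball 0 R"]) auto
      moreover have "((\<lambda>t. of_real t * z) has_vector_derivative z) (at t)"
        by (auto intro!: derivative_eq_intros)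
      ultimately have g: "((\<lambda>t. g (of_real t * z)) has_vector_derivative
          z * deriv g (of_real t * z)) (at t)"
        using field_vector_diff_chain_at by (fastforce simp: o_def)
      have "((\<lambda>t. of_real (t powr c) :: complex) has_vector_derivative
          of_real (c * t powr (c - 1))) (at t)"
        using powr
        by (intro has_vector_derivative_of_real)
          (simp add: has_real_derivative_iff_has_vector_derivative)
      from has_vector_derivative_mult[OF this g]
      have "(f has_vector_derivative of_real (t powr c) * (z * deriv g (of_real t * z)) +
          of_real (c * t powr (c - 1)) * g (of_real t * z)) (at t)"
        by (simp add: f_def)
      moreover have "t powr c = t powr (c - 1) * t"
        using t by (simp add: powr_diff)
      ultimately show "(f has_vector_derivative of_real (t powr (c - 1) / b) *
          (of_real a * g (of_real t * z) + of_real b * (of_real t * z) * deriv g (of_real t * z))) (at t)"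
        using \<open>b > 0\<close> by (simp add: c_def field_simps)
      have "norm (of_real a * g (of_real t * z) +
          of_real b * (of_real t * z) * deriv g (of_real t * z)) \<le> K"
        using ball[of t] t z by (intro bound) auto
      then have "t powr (c - 1) / b * norm (of_real a * g (of_real t * z) +
          of_real b * (of_real t * z) * deriv g (of_real t * z)) \<le> t powr (c - 1) / b * K"
        using \<open>b > 0\<close> by (intro mult_left_mono) auto
      also have "\<dots> = K / a * (c * t powr (c - 1))"
        using assms(1,2) by (simp add: c_def)
      finally show "norm (of_real (t powr (c - 1) / b) *
          (of_real a * g (of_real t * z) + of_real b * (of_real t * z) * deriv g (of_real t * z)))
          \<le> K / a * (c * t powr (c - 1))"
        using \<open>b > 0\<close> by (simp add: norm_mult norm_divide)
    qed simp
    \<comment> \<open>Here f 1 = g z, and f 0 = 0 because \<open>0 powr c = 0\<close>.\<close>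
    then show ?thesis
      by (simp add: f_def)
  qed
  have "R > 0"
    using z by (auto intro: le_less_trans[OF norm_ge_zero])
  have "norm (g 0) \<le> K / a"
  proof (rule tendsto_upperbound)
    have "isCont g 0"
      using hol \<open>R > 0\<close> holomorphic_on_imp_continuous_on continuous_on_interior
      by (metis centre_in_ball interior_ball)
    then show "((\<lambda>z. norm (g z)) \<longlongrightarrow> norm (g 0)) (at 0)"
      by (intro tendsto_norm) (simp add: isCont_def)
    show "\<forall>\<^sub>F z in at 0. norm (g z) \<le> K / a"
      using eventually_at_in_open[of "ball 0 R" 0] \<open>R > 0\<close>
      by (auto elim!: eventually_mono intro!: nz)
  qed simp
  with nz z show ?thesis
    by (cases "z = 0") auto
qed

theorem theorem3p2:
  fixes \<beta>1 \<beta>2 C D :: real and p :: "complex \<Rightarrow> complex"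
  assumes "\<beta>1 > 0" and "\<beta>2 > 0"
    and "-1 < D" and "D < C" and "C \<le> 1"
    and "(2 * \<beta>1 - \<beta>2) * (1 - D\<^sup>2) \<ge> 2 * sqrt 2 * (C - D) * (1 + \<bar>D\<bar>)"
    and "p analytic_on ball 0 1" and "p 0 = 1"
    and "(\<lambda>z. 1 + of_real \<beta>1 * z * deriv p z + of_real \<beta>2 * z\<^sup>2 * deriv (deriv p) z)
           \<prec>\<^sub>s (\<lambda>z. (1 + of_real C * z) / (1 + of_real D * z))"
  shows "p \<prec>\<^sub>s (\<lambda>z. 1 + arsinh z)"
proof -
  have D: "\<bar>D\<bar> < 1"
    using assms(3-5) by auto
  define K where "K = (C - D) / (1 - \<bar>D\<bar>)"
  have holp: "p holomorphic_on ball 0 1"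
    using assms(7) by (simp add: analytic_on_open)
  then have holg: "deriv p holomorphic_on ball 0 1"
    by (intro holomorphic_deriv) auto
  obtain w where w: "\<And>z. z \<in> ball 0 1 \<Longrightarrow> norm (w z) \<le> norm z"
    "\<And>z. z \<in> ball 0 1 \<Longrightarrow>
      1 + of_real \<beta>1 * z * deriv p z + of_real \<beta>2 * z\<^sup>2 * deriv (deriv p) z =
        (1 + of_real C * w z) / (1 + of_real D * w z)"
    using assms(9) unfolding subordinate_def by blast
  have bound: "norm (of_real \<beta>1 * deriv p z + of_real \<beta>2 * z * deriv (deriv p) z) \<le> K"
    if z: "z \<in> ball 0 1 - {0}" for z
  proof -
    have "\<bar>D\<bar> * norm (w z) \<le> \<bar>D\<bar> * 1"
      using w(1)[of z] z by (intro mult_left_mono) auto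
    moreover have "1 - norm (of_real D * w z) \<le> norm (1 + of_real D * w z)"
      using norm_diff_ineq[of 1 "of_real D * w z"] by simp
    ultimately have den: "1 - \<bar>D\<bar> \<le> norm (1 + of_real D * w z)"
      by (simp add: norm_mult)
    then have "1 + of_real D * w z \<noteq> 0"
      using D by auto
    \<comment> \<open>Subtracting 1 from the quotient leaves (C - D) w / (1 + D w). As \<bar>w\<bar>
      \<le> \<bar>z\<bar>, the factor \<open>norm z\<close> can be cancelled below.\<close>
    then have "z * (of_real \<beta>1 * deriv p z + of_real \<beta>2 * z * deriv (deriv p) z) =
        of_real (C - D) * w z / (1 + of_real D * w z)"
      using w(2)[of z] z by (simp add: field_simps power2_eq_square)
    then have "norm z * norm (of_real \<beta>1 * deriv p z + of_real \<beta>2 * z * deriv (deriv p) z) =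
        (C - D) * norm (w z) / norm (1 + of_real D * w z)"
      using assms(4) by (metis abs_of_pos diff_gt_0_iff_gt norm_divide norm_mult norm_of_real)
    also have "\<dots> \<le> (C - D) * norm z / (1 - \<bar>D\<bar>)"
      using assms(4) D den w(1)[of z] z by (intro frac_le mult_left_mono) auto
    also have "\<dots> = norm z * K"
      by (simp add: K_def)
    finally show ?thesis
      using z by simp
  qed
  have "norm (deriv p z) \<le> K / \<beta>1" if "z \<in> ball 0 1" for z
    using norm_le_if_first_order_differential_bound[OF assms(1,2) holg bound that] .
  then have p1: "norm (p z - p 0) \<le> K / \<beta>1 * norm (z - 0)" if "z \<in> ball 0 1" for z
    using that holp
    by (intro field_differentiable_bound[where S = "ball 0 1" and f' = "deriv p"])
      (auto intro: holomorphic_derivI)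
  \<comment> \<open>Cancelling 1 + \<bar>D\<bar> turns the parameter condition into
    \<open>2 * sqrt 2 * K \<le> 2 * \<beta>1 - \<beta>2\<close>. Positivity of
    \<open>\<beta>2\<close> makes the bound strict, and 4/3 \<le> sqrt 2 makes it rational.\<close>
  have "K / \<beta>1 < 3/4"
  proof -
    have "1 - D\<^sup>2 = (1 - \<bar>D\<bar>) * (1 + \<bar>D\<bar>)"
      by (simp add: algebra_simps power2_eq_square)
    then have "(2 * sqrt 2 * (C - D)) * (1 + \<bar>D\<bar>) \<le> ((2 * \<beta>1 - \<beta>2) * (1 - \<bar>D\<bar>)) * (1 + \<bar>D\<bar>)"
      using assms(6) by (simp add: mult.assoc)
    then have "2 * sqrt 2 * (C - D) \<le> (2 * \<beta>1 - \<beta>2) * (1 - \<bar>D\<bar>)"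
      by (rule mult_right_le_imp_le) simp
    then have "2 * sqrt 2 * K \<le> 2 * \<beta>1 - \<beta>2"
      using D by (simp add: K_def field_simps)
    moreover have "K > 0"
      using assms(4) D by (simp add: K_def)
    moreover have "4/3 \<le> sqrt 2"
      by (rule real_le_rsqrt) (simp add: power2_eq_square)
    ultimately have "2 * (4/3) * K < 2 * \<beta>1"
      using mult_right_mono[of "4/3" "sqrt 2" K] assms(2) by linarith
    then show ?thesis
      using assms(1) by (simp add: field_simps)
  qed
  then have small: "norm (p z - 1) \<le> 3/4" if "z \<in> ball 0 1" for z
  proof -
    have "K / \<beta>1 * norm z \<le> 3/4 * 1"
      using \<open>K / \<beta>1 < 3/4\<close> that by (intro mult_mono) auto
    moreover have "norm (p z - 1) \<le> K / \<beta>1 * norm z"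
      using p1[OF that] assms(8) by simp
    ultimately show ?thesis
      by linarith
  qed
  have an: "(\<lambda>z. sinh (p z - 1)) analytic_on ball 0 1"
    by (intro analytic_intros assms(7))
  \<comment> \<open>The function vanishes at 0 since p 0 = 1 and maps the disc into itself, so the
    Schwarz lemma applies.\<close>
  have "norm (sinh (p z - 1)) \<le> norm z" if "z \<in> ball 0 1" for z
    using an that small assms(8)
    by (intro Schwarz_Lemma(1)) (auto simp: analytic_on_open intro!: norm_sinh_less_1)
  \<comment> \<open>The imaginary part of p z - 1 is at most 3/4 < pi/2 in modulus, inside the strip
    of inversion.\<close>
  moreover have "p z = 1 + arsinh (sinh (p z - 1))" if "z \<in> ball 0 1" for z
    using small[OF that] abs_Im_le_cmod[of "p z - 1"] pi_gt3
    by (subst arsinh_sinh_complex) auto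
  moreover have "(\<lambda>z::complex. 1 + arsinh z) analytic_on ball 0 1"
    by (intro analytic_intros analytic_on_arsinh_ball)
  ultimately show ?thesis
    unfolding subordinate_def using assms(7,8) an
    by (intro conjI exI[of _ "\<lambda>z. sinh (p z - 1)"]) auto
qed

end
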